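(* Let $N\in\mathbb{N}$, $N\ge 2$, let $\mathcal{S}=(\sigma(n))_{n\in\mathbb{N}_0}\subseteq\mathbb{N}_0$ be a list with $\sigma(0)=0$ such that $m_n:=\sigma(n+1)-\sigma(n)\in\{1,2,\ldots,N-1\}$ for all $n\in\mathbb{N}_0$, let $x_0\in\mathbb{X}$, and let $\overline{\alpha}\in(0,1]$ be fixed. Let $(x_n)_{n\in\mathbb{N}_0}$ be the closed loop trajectory at the update instants, $x_{n+1}=x_{u_N}(m_n;x_n)$, generated by the multistep MPC feedback $\mu_N^{\mathcal{S}}$. If the optimal value function $V_N$ satisfies $$V_N(x_n)\ \ge\ V_N(x_{n+1})+\overline{\alpha}\sum_{k=0}^{m_n-1}\ell\big(x_{u_N}(k;x_n),u_N(k;x_n)\big)\qquad\text{for all } n\in\mathbb{N}_0,$$ then $$\overline{\alpha}\,V_\infty(x_0)\ \le\ \overline{\alpha}\,V_\infty^{\mu_N^{\mathcal{S}}}(x_0)\ \le\ V_N(x_0)\ \le\ V_\infty(x_0).$$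
   Context: Let $X,U$ be Banach spaces with metrics $d_X,d_U$, let $\mathbb{X}\subset X$, $\mathbb{U}\subset U$ (state and control constraints), and let $f:X\times U\to X$ define the system $x(n+1)=f(x(n),u(n))$, $x(0)=x_0$. For a control sequence $u$, $x_u(\cdot;x_0)$ denotes the resulting trajectory with $x_u(0;x_0)=x_0$. Let $x^\star\in\mathbb{X}$ and $u^\star\in\mathbb{U}$ with $f(x^\star,u^\star)=x^\star$. The stage cost $\ell:X\times U\to[0,\infty)$ is continuous, $\ell(x^\star,u^\star)=0$, and $\ell(x,u)>0$ for all $u\in U$ and all $x\ne x^\star$. Viability is assumed: for every $x\in\mathbb{X}$ there is $u_x\in\mathbb{U}$ with $f(x,u_x)\in\mathbb{X}$. Infinite horizon: $J_\infty(x_0,u)=\sum_{n=0}^\infty\ell(x_u(n;x_0),u(n))$ and $V_\infty(x_0)=\inf J_\infty(x_0,u)$ over all $u:\mathbb{N}_0\to\mathbb{U}$ with $x_u(n;x_0)\in\mathbb{X}$ for all $n\in\mathbb{N}$ (values in $[0,\infty]$). Finite horizon: for $M\in\mathbb{N}$, $J_M(x_0,u)=\sum_{k=0}^{M-1}\ell(x_u(k;x_0),u(k))$, and $V_M(x_0)$ is the minimum of $J_M(x_0,u)$ over all $u\in\mathbb{U}^M$ with $x_u(k;x_0)\in\mathbb{X}$ for $k=1,\ldots,M$. Minima are assumed to be attained. $u_N(\cdot;x_0)$ denotes a (chosen) minimizer for horizon $N$, and $x_{u_N}(\cdot;x_0)$ the corresponding open loop trajectory. Multistep MPC: at each update instant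 $\sigma(n)$, in state $x_n$, the first $m_n$ elements of $u_N(\cdot;x_n)$ are applied, i.e. $\mu_N^{\mathcal{S}}(k;x_n)=u_N(k;x_n)$ for $k=0,\ldots,m_n-1$ (by Bellman's principle this minimizes $V_{N-m_n}(x_u(m_n;x_n))+\sum_{k=0}^{m_n-1}\ell(x_u(k;x_n),u(k))$). The closed loop cost is $$V_\infty^{\mu_N^{\mathcal{S}}}(x_0)=\sum_{n=0}^\infty\sum_{k=0}^{m_n-1}\ell\big(x_{u_N}(k;x_n),\mu_N^{\mathcal{S}}(k;x_n)\big).$$ *)

theory Defs
  imports "HOL-Analysis.Analysis"
begin

primrec traj :: "('x \<Rightarrow> 'u \<Rightarrow> 'x) \<Rightarrow> (nat \<Rightarrow> 'u) \<Rightarrow> 'x \<Rightarrow> nat \<Rightarrow> 'x" where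
  "traj f u x 0 = x"
| "traj f u x (Suc n) = f (traj f u x n) (u n)"

definition cost_inf ::
    "('x \<Rightarrow> 'u \<Rightarrow> 'x) \<Rightarrow> ('x \<Rightarrow> 'u \<Rightarrow> real) \<Rightarrow> 'x \<Rightarrow> (nat \<Rightarrow> 'u) \<Rightarrow> ennreal" where
  "cost_inf f l x u = (\<Sum>n. ennreal (l (traj f u x n) (u n)))"

definition admissible_inf ::
    "('x \<Rightarrow> 'u \<Rightarrow> 'x) \<Rightarrow> 'x set \<Rightarrow> 'u set \<Rightarrow> 'x \<Rightarrow> (nat \<Rightarrow> 'u) set" where
  "admissible_inf f XX UU x = {u. (\<forall>n. u n \<in> UU) \<and> (\<forall>n\<ge>1. traj f u x n \<in> XX)}"

definition value_inf ::
    "('x \<Rightarrow> 'u \<Rightarrow> 'x) \<Rightarrow> 'x set \<Rightarrow> 'u set \<Rightarrow> ('x \<Rightarrow> 'u \<Rightarrow> real) \<Rightarrow> 'x \<Rightarrow> ennreal" where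
  "value_inf f XX UU l x = (INF u \<in> admissible_inf f XX UU x. cost_inf f l x u)"

definition cost_fin ::
    "('x \<Rightarrow> 'u \<Rightarrow> 'x) \<Rightarrow> ('x \<Rightarrow> 'u \<Rightarrow> real) \<Rightarrow> nat \<Rightarrow> 'x \<Rightarrow> (nat \<Rightarrow> 'u) \<Rightarrow> real" where
  "cost_fin f l M x u = (\<Sum>k<M. l (traj f u x k) (u k))"

(* The power UU^M is the extensional function space on the index set {..<M}; the states
   traj f u x k with k \<le> M and the cost over M steps only use the entries u 0, ..., u (M - 1). *)
definition admissible_fin ::
    "('x \<Rightarrow> 'u \<Rightarrow> 'x) \<Rightarrow> 'x set \<Rightarrow> 'u set \<Rightarrow> nat \<Rightarrow> 'x \<Rightarrow> (nat \<Rightarrow> 'u) set" where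
  "admissible_fin f XX UU M x =
     {u \<in> {..<M} \<rightarrow>\<^sub>E UU. \<forall>k\<in>{1..M}. traj f u x k \<in> XX}"

definition is_minimizer ::
    "('x \<Rightarrow> 'u \<Rightarrow> 'x) \<Rightarrow> 'x set \<Rightarrow> 'u set \<Rightarrow> ('x \<Rightarrow> 'u \<Rightarrow> real) \<Rightarrow> nat \<Rightarrow> 'x \<Rightarrow> (nat \<Rightarrow> 'u) \<Rightarrow> bool" where
  "is_minimizer f XX UU l M x u \<longleftrightarrow>
     is_arg_min (cost_fin f l M x) (\<lambda>v. v \<in> admissible_fin f XX UU M x) u"

(* A real infimum, hence meaningful for a nonempty set of admissible controls and nonnegative
   costs; it is the minimum whenever a minimizer exists. Under the assumptions of the locale
   below this is the case for every x in XX. *)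
definition value_fin ::
    "('x \<Rightarrow> 'u \<Rightarrow> 'x) \<Rightarrow> 'x set \<Rightarrow> 'u set \<Rightarrow> ('x \<Rightarrow> 'u \<Rightarrow> real) \<Rightarrow> nat \<Rightarrow> 'x \<Rightarrow> real" where
  "value_fin f XX UU l M x = (INF u \<in> admissible_fin f XX UU M x. cost_fin f l M x u)"

(* The metrics need not be the ones induced by the norms: dX and dU only enter
   through the continuity of the stage cost, and dX = dist, dU = dist is allowed. *)
locale optimal_control_problem =
  X: Metric_space UNIV dX + U: Metric_space UNIV dU
  for dX :: "'x::banach \<Rightarrow> 'x \<Rightarrow> real" and dU :: "'u::banach \<Rightarrow> 'u \<Rightarrow> real" +
  fixes f :: "'x \<Rightarrow> 'u \<Rightarrow> 'x"
    and XX :: "'x set" and UU :: "'u set"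
    and xs :: 'x and us :: 'u
    and l :: "'x \<Rightarrow> 'u \<Rightarrow> real"
  assumes equilibrium: "xs \<in> XX" "us \<in> UU" "f xs us = xs"
    and l_nonneg: "l x u \<ge> 0"
    and l_continuous:
      "continuous_map (prod_topology X.mtopology U.mtopology) euclideanreal (\<lambda>(x, u). l x u)"
    and l_equilibrium: "l xs us = 0"
    and l_pos: "x \<noteq> xs \<Longrightarrow> l x u > 0"
    and viable: "x \<in> XX \<Longrightarrow> \<exists>u\<in>UU. f x u \<in> XX"
    and minimum_attained: "x \<in> XX \<Longrightarrow> \<exists>u. is_minimizer f XX UU l M x u"

text \<open>
  For multistep MPC, \<open>uN x\<close> is the chosen minimizer for horizon \<open>N\<close> and initial state \<open>x\<close>,
  and \<open>s n\<close> is the \<open>n\<close>-th update instant.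
\<close>

definition step_length :: "(nat \<Rightarrow> nat) \<Rightarrow> nat \<Rightarrow> nat" where
  "step_length s n = s (Suc n) - s n"

definition mpc_feedback :: "('x \<Rightarrow> nat \<Rightarrow> 'u) \<Rightarrow> (nat \<Rightarrow> nat) \<Rightarrow> nat \<Rightarrow> 'x \<Rightarrow> nat \<Rightarrow> 'u" where
  "mpc_feedback uN s n x = restrict (uN x) {..<step_length s n}"

primrec mpc_state ::
    "('x \<Rightarrow> 'u \<Rightarrow> 'x) \<Rightarrow> ('x \<Rightarrow> nat \<Rightarrow> 'u) \<Rightarrow> (nat \<Rightarrow> nat) \<Rightarrow> 'x \<Rightarrow> nat \<Rightarrow> 'x" where
  "mpc_state f uN s x0 0 = x0"
| "mpc_state f uN s x0 (Suc n) =
     traj f (uN (mpc_state f uN s x0 n)) (mpc_state f uN s x0 n) (step_length s n)"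

definition closed_loop_cost ::
    "('x \<Rightarrow> 'u \<Rightarrow> 'x) \<Rightarrow> ('x \<Rightarrow> 'u \<Rightarrow> real) \<Rightarrow> ('x \<Rightarrow> nat \<Rightarrow> 'u) \<Rightarrow> (nat \<Rightarrow> nat) \<Rightarrow> 'x \<Rightarrow> ennreal" where
  "closed_loop_cost f l uN s x0 =
     (\<Sum>n. let x = mpc_state f uN s x0 n in
        \<Sum>k<step_length s n. ennreal (l (traj f (uN x) x k) (mpc_feedback uN s n x k)))"

end

theory Submission
  imports Defs
begin

text \<open>
  The three inequalities have three different sources.

  The first one holds because the closed loop is itself a competitor in the infinite horizon
  problem. Concatenating the pieces of the finite horizon minimizers that the multistep feedback
  applies gives one control sequence (\<open>concat_control\<close>). It is admissible
  (\<open>concat_control_admissible\<close>), since no piece is longer than \<open>N\<close> and the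
  minimizers are admissible, and its infinite horizon cost is the closed loop cost
  (\<open>cost_inf_concat_control\<close>), since grouping the terms of a series of nonnegative numbers
  into consecutive blocks does not change its value. Hence its cost is an upper bound for the
  infimum \<open>value_inf\<close>.

  The second one is relaxed dynamic programming: the assumed decrease of the optimal value
  function telescopes (\<open>suminf_le_of_decrease\<close>), so \<open>\<alpha>\<close> times the cost of the first \<open>n\<close> blocks is at
  most \<open>V\<^sub>N(x\<^sub>0) - V\<^sub>N(x\<^sub>n)\<close>, and \<open>V\<^sub>N(x\<^sub>n) \<ge> 0\<close>
  (\<open>value_fin_nonneg\<close>).

  The third one is truncation: the first \<open>N\<close> values of an admissible infinite control
  sequence are admissible for the horizon \<open>N\<close>, and dropping nonnegative terms only lowers
  the cost (\<open>value_fin_le_value_inf\<close>).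
\<close>

section \<open>Finite and infinite horizon\<close>

lemma traj_cong:
  assumes "\<And>k. k < n \<Longrightarrow> u k = v k"
  shows "traj f u x n = traj f v x n"
  using assms by (induction n) auto

lemma value_fin_le_cost_fin:
  assumes l_nonneg: "\<And>x u. l x u \<ge> 0"
    and "u \<in> admissible_fin f XX UU M x"
  shows "value_fin f XX UU l M x \<le> cost_fin f l M x u"
proof -
  have "bdd_below (cost_fin f l M x ` admissible_fin f XX UU M x)"
    by (rule bdd_belowI2[where m = 0]) (auto simp: cost_fin_def intro: sum_nonneg l_nonneg)
  then show ?thesis
    unfolding value_fin_def using assms(2) by (rule cINF_lower)
qed

text \<open>The real infimum of an empty set is an unspecified number; hence the hypothesis that some control
  sequence is admissible.\<close>

lemma value_fin_nonneg:
  assumes l_nonneg: "\<And>x u. l x u \<ge> 0"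
    and "admissible_fin f XX UU M x \<noteq> {}"
  shows "value_fin f XX UU l M x \<ge> 0"
  unfolding value_fin_def cost_fin_def
  using assms(2) by (intro cINF_greatest sum_nonneg l_nonneg)

lemma restrict_admissible_fin:
  assumes "u \<in> admissible_inf f XX UU x"
  shows "restrict u {..<M} \<in> admissible_fin f XX UU M x"
proof -
  have "traj f (restrict u {..<M}) x k = traj f u x k" if "k \<le> M" for k
    using that by (intro traj_cong) auto
  then show ?thesis
    using assms by (auto simp: admissible_fin_def admissible_inf_def)
qed

lemma cost_fin_restrict: "cost_fin f l M x (restrict u {..<M}) = cost_fin f l M x u"
proof -
  have "traj f (restrict u {..<M}) x k = traj f u x k" if "k < M" for k
    using that by (intro traj_cong) auto
  then show ?thesis
    by (simp add: cost_fin_def)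
qed

lemma cost_fin_le_cost_inf:
  assumes l_nonneg: "\<And>x u. l x u \<ge> 0"
  shows "ennreal (cost_fin f l M x u) \<le> cost_inf f l x u"
proof -
  have "ennreal (cost_fin f l M x u) = (\<Sum>k<M. ennreal (l (traj f u x k) (u k)))"
    unfolding cost_fin_def by (simp add: l_nonneg)
  also have "\<dots> \<le> cost_inf f l x u"
    unfolding cost_inf_def by (intro sum_le_suminf) auto
  finally show ?thesis .
qed

text \<open>Truncating an admissible infinite control sequence gives a competitor for the finite
  horizon that is not more expensive.\<close>

lemma value_fin_le_value_inf:
  assumes l_nonneg: "\<And>x u. l x u \<ge> 0"
  shows "ennreal (value_fin f XX UU l M x) \<le> value_inf f XX UU l x"
  unfolding value_inf_def
proof (rule INF_greatest)
  fix u assume u: "u \<in> admissible_inf f XX UU x"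
  have "value_fin f XX UU l M x \<le> cost_fin f l M x (restrict u {..<M})"
    using l_nonneg restrict_admissible_fin[OF u] by (rule value_fin_le_cost_fin)
  then have "ennreal (value_fin f XX UU l M x) \<le> ennreal (cost_fin f l M x u)"
    unfolding cost_fin_restrict by (rule ennreal_leI)
  also have "\<dots> \<le> cost_inf f l x u"
    using l_nonneg by (rule cost_fin_le_cost_inf)
  finally show "ennreal (value_fin f XX UU l M x) \<le> cost_inf f l x u" .
qed

section \<open>Blocks between update instants\<close>

lemma update_instant_Suc:
  assumes "step_length s n \<ge> 1"
  shows "s (Suc n) = s n + step_length s n"
  using assms by (simp add: step_length_def)

lemma strict_mono_update_instants:
  assumes "\<And>n. step_length s n \<ge> 1"
  shows "strict_mono s"
  unfolding strict_mono_Suc_iff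
proof
  show "s n < s (Suc n)" for n
    using assms[of n] by (simp add: step_length_def)
qed

definition block :: "(nat \<Rightarrow> nat) \<Rightarrow> nat \<Rightarrow> nat" where
  "block s t = (LEAST n. t < s (Suc n))"

lemma block_eq:
  assumes "\<And>n. step_length s n \<ge> 1" and "k < step_length s n"
  shows "block s (s n + k) = n"
  unfolding block_def
proof (rule Least_equality)
  show "s n + k < s (Suc n)"
    using assms by (simp add: update_instant_Suc)
  fix m assume "s n + k < s (Suc m)"
  then have "s n < s (Suc m)" by simp
  then have "n < Suc m"
    using strict_mono_update_instants[OF assms(1)] by (simp add: strict_mono_less)
  then show "n \<le> m" by simp
qed

lemma block_decomposition:
  assumes "\<And>n. step_length s n \<ge> 1" and "s 0 = 0"
  obtains n k where "t = s n + k" and "k < step_length s n"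
proof -
  have "\<exists>n k. t = s n + k \<and> k < step_length s n"
  proof (induction t)
    case 0
    have "0 = s 0 + 0 \<and> 0 < step_length s 0"
      using assms(2) assms(1)[of 0] by linarith
    then show ?case by blast
  next
    case (Suc t)
    then obtain n k where nk: "t = s n + k" "k < step_length s n" by blast
    show ?case
    proof (cases "Suc k < step_length s n")
      case True
      then show ?thesis using nk by (metis add_Suc_right)
    next
      \<comment> \<open>The block \<open>n\<close> is used up, and \<open>Suc t\<close> is the first time of the next one.\<close>
      case False
      then have "Suc t = s (Suc n) + 0"
        using nk assms(1)[of n] by (simp add: update_instant_Suc)
      moreover have "0 < step_length s (Suc n)"
        using assms(1)[of "Suc n"] by linarith
      ultimately show ?thesis by blast
    qed
  qed
  then show thesis using that by blast
qed

lemma sum_up_to_update_instant: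
  fixes g :: "nat \<Rightarrow> 'a::comm_monoid_add"
  assumes "\<And>n. step_length s n \<ge> 1" and "s 0 = 0"
  shows "(\<Sum>t<s n. g t) = (\<Sum>i<n. \<Sum>k<step_length s i. g (s i + k))"
proof (induction n)
  case 0
  then show ?case by (simp add: assms(2))
next
  case (Suc n)
  have "(\<Sum>t<s n + m. g t) = (\<Sum>t<s n. g t) + (\<Sum>k<m. g (s n + k))" for m
    by (induction m) (simp_all add: add.assoc)
  then show ?case
    using Suc assms(1)[of n] by (simp add: update_instant_Suc)
qed

text \<open>The partial sums of the grouped series are a subsequence of the partial sums of the
  original one, and in \<^typ>\<open>ennreal\<close> every series converges.\<close>

lemma suminf_blocks:
  fixes g :: "nat \<Rightarrow> ennreal"
  assumes "\<And>n. step_length s n \<ge> 1" and "s 0 = 0"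
  shows "(\<Sum>n. \<Sum>k<step_length s n. g (s n + k)) = (\<Sum>t. g t)"
proof -
  have "(\<lambda>n. \<Sum>t<n. g t) \<longlonglongrightarrow> (\<Sum>t. g t)"
    by (rule summable_LIMSEQ) simp
  then have "(\<lambda>n. \<Sum>t<s n. g t) \<longlonglongrightarrow> (\<Sum>t. g t)"
    using LIMSEQ_subseq_LIMSEQ[OF _ strict_mono_update_instants[OF assms(1)]]
    by (simp add: comp_def)
  then have "(\<lambda>n. \<Sum>k<step_length s n. g (s n + k)) sums (\<Sum>t. g t)"
    unfolding sums_def sum_up_to_update_instant[OF assms] .
  then show ?thesis by (rule sums_unique[symmetric])
qed

section \<open>The closed loop as one infinite control sequence\<close>

definition concat_control ::
    "('x \<Rightarrow> 'u \<Rightarrow> 'x) \<Rightarrow> ('x \<Rightarrow> nat \<Rightarrow> 'u) \<Rightarrow> (nat \<Rightarrow> nat) \<Rightarrow> 'x \<Rightarrow> nat \<Rightarrow> 'u" where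
  "concat_control f uN s x0 t = uN (mpc_state f uN s x0 (block s t)) (t - s (block s t))"

lemma concat_control_block:
  assumes "\<And>n. step_length s n \<ge> 1" and "k < step_length s n"
  shows "concat_control f uN s x0 (s n + k) = uN (mpc_state f uN s x0 n) k"
  by (simp add: concat_control_def block_eq[OF assms])

text \<open>The case \<open>k = step_length s n\<close> is included because it carries the induction
  from one block to the next: there the open loop trajectory arrives at the next update state.\<close>

lemma traj_concat_control:
  assumes "\<And>n. step_length s n \<ge> 1" and "s 0 = 0" and "k \<le> step_length s n"
  shows "traj f (concat_control f uN s x0) x0 (s n + k)
    = traj f (uN (mpc_state f uN s x0 n)) (mpc_state f uN s x0 n) k"
proof -
  let ?w = "concat_control f uN s x0" and ?x = "mpc_state f uN s x0"
  have within_block: "traj f ?w x0 (s n + k) = traj f (uN (?x n)) (?x n) k"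
    if start: "traj f ?w x0 (s n) = ?x n" and "k \<le> step_length s n" for n k
    using that(2)
  proof (induction k)
    case 0
    then show ?case by (simp add: start)
  next
    case (Suc k)
    then show ?case by (simp add: concat_control_block[OF assms(1)])
  qed
  have "traj f ?w x0 (s n) = ?x n"
  proof (induction n)
    case 0
    then show ?case by (simp add: assms(2))
  next
    case (Suc n)
    then show ?case
      using within_block[OF Suc order_refl] assms(1)[of n] by (simp add: update_instant_Suc)
  qed
  then show ?thesis
    using assms(3) by (rule within_block)
qed

lemma mpc_state_in_constraints:
  assumes "\<And>n. step_length s n \<in> {1..N}"
    and uN_admissible: "\<And>y. y \<in> XX \<Longrightarrow> uN y \<in> admissible_fin f XX UU N y"
    and "x0 \<in> XX"
  shows "mpc_state f uN s x0 n \<in> XX"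
proof (induction n)
  case 0
  then show ?case by (simp add: assms(3))
next
  case (Suc n)
  then show ?case
    using uN_admissible[OF Suc] assms(1)[of n] by (simp add: admissible_fin_def)
qed

lemma concat_control_admissible:
  assumes steps: "\<And>n. step_length s n \<in> {1..N}" and "s 0 = 0"
    and uN_admissible: "\<And>y. y \<in> XX \<Longrightarrow> uN y \<in> admissible_fin f XX UU N y"
    and "x0 \<in> XX"
  shows "concat_control f uN s x0 \<in> admissible_inf f XX UU x0"
proof -
  let ?w = "concat_control f uN s x0" and ?x = "mpc_state f uN s x0"
  have pos: "step_length s n \<ge> 1" for n
    using steps[of n] by simp
  have "?w t \<in> UU \<and> traj f ?w x0 t \<in> XX" for t
  proof -
    obtain n k where nk: "t = s n + k" "k < step_length s n"
      using block_decomposition[OF pos assms(2)] .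
    have x: "?x n \<in> XX"
      using mpc_state_in_constraints[OF steps uN_admissible assms(4)] .
    have adm: "uN (?x n) \<in> admissible_fin f XX UU N (?x n)"
      using uN_admissible[OF x] .
    have "k < N"
      using nk(2) steps[of n] by simp
    with adm have "uN (?x n) k \<in> UU"
      by (auto simp: admissible_fin_def)
    \<comment> \<open>Admissibility constrains the states only from time \<open>1\<close> on, so the start of a
      block is treated separately.\<close>
    moreover have "traj f (uN (?x n)) (?x n) k \<in> XX"
      using x adm \<open>k < N\<close> by (cases k) (simp_all add: admissible_fin_def del: traj.simps(2))
    ultimately show ?thesis
      using nk by (simp add: concat_control_block[OF pos] traj_concat_control[OF pos assms(2)])
  qed
  then show ?thesis
    by (simp add: admissible_inf_def)
qed

lemma closed_loop_cost_open_loop: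
  "closed_loop_cost f l uN s x0 =
    (\<Sum>n. \<Sum>k<step_length s n.
      ennreal (l (traj f (uN (mpc_state f uN s x0 n)) (mpc_state f uN s x0 n) k)
        (uN (mpc_state f uN s x0 n) k)))"
  by (simp add: closed_loop_cost_def mpc_feedback_def Let_def)

lemma cost_inf_concat_control:
  assumes "\<And>n. step_length s n \<ge> 1" and "s 0 = 0"
  shows "cost_inf f l x0 (concat_control f uN s x0) = closed_loop_cost f l uN s x0"
proof -
  let ?w = "concat_control f uN s x0"
  have "cost_inf f l x0 ?w
    = (\<Sum>n. \<Sum>k<step_length s n. ennreal (l (traj f ?w x0 (s n + k)) (?w (s n + k))))"
    unfolding cost_inf_def by (rule suminf_blocks[OF assms, symmetric])
  also have "\<dots> = closed_loop_cost f l uN s x0"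
    unfolding closed_loop_cost_open_loop
    by (simp add: concat_control_block[OF assms(1)] traj_concat_control[OF assms])
  finally show ?thesis .
qed

section \<open>Relaxed dynamic programming\<close>

text \<open>The differences of \<open>V\<close> telescope to \<open>V 0 - V K\<close>, which is at most
  \<open>V 0\<close>. This bounds every partial sum, so in \<^typ>\<open>ennreal\<close> the series needs no
  separate argument for its convergence.\<close>

lemma suminf_le_of_decrease:
  fixes V c :: "nat \<Rightarrow> real"
  assumes V_nonneg: "\<And>n. V n \<ge> 0" and c_nonneg: "\<And>n. c n \<ge> 0" and "\<alpha> \<ge> 0"
    and decrease: "\<And>n. V n \<ge> V (Suc n) + \<alpha> * c n"
  shows "ennreal \<alpha> * (\<Sum>n. ennreal (c n)) \<le> ennreal (V 0)"
proof -
  have "(\<Sum>n<K. ennreal \<alpha> * ennreal (c n)) \<le> ennreal (V 0)" for K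
  proof -
    have "(\<Sum>n<K. \<alpha> * c n) \<le> V 0 - V K"
    proof (induction K)
      case (Suc K)
      then show ?case using decrease[of K] by simp
    qed simp
    also have "\<dots> \<le> V 0"
      using V_nonneg[of K] by simp
    finally have "ennreal (\<Sum>n<K. \<alpha> * c n) \<le> ennreal (V 0)"
      by (rule ennreal_leI)
    then show ?thesis
      using assms(3) by (simp add: ennreal_mult c_nonneg flip: sum_ennreal)
  qed
  then show ?thesis
    unfolding ennreal_suminf_cmult[symmetric] by (intro suminf_le_const) simp_all
qed

theorem proposition4p3:
  fixes dX :: "'x::banach \<Rightarrow> 'x \<Rightarrow> real" and dU :: "'u::banach \<Rightarrow> 'u \<Rightarrow> real"
    and f :: "'x \<Rightarrow> 'u \<Rightarrow> 'x"
    and XX :: "'x set" and UU :: "'u set"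
    and xs :: 'x and us :: 'u
    and l :: "'x \<Rightarrow> 'u \<Rightarrow> real"
    and N :: nat and s :: "nat \<Rightarrow> nat"
    and uN :: "'x \<Rightarrow> nat \<Rightarrow> 'u"
    and x0 :: 'x and \<alpha> :: real and x :: "nat \<Rightarrow> 'x"
  assumes "optimal_control_problem dX dU f XX UU xs us l"
    and "N \<ge> 2"
    and "s 0 = 0" and "\<And>n. step_length s n \<in> {1..N - 1}"
    and "\<And>y. y \<in> XX \<Longrightarrow> is_minimizer f XX UU l N y (uN y)"
    and "x0 \<in> XX"
    and "0 < \<alpha>" and "\<alpha> \<le> 1"
    and "x = mpc_state f uN s x0"
    and "\<And>n. value_fin f XX UU l N (x n) \<ge>
           value_fin f XX UU l N (x (Suc n)) +
           \<alpha> * (\<Sum>k<step_length s n. l (traj f (uN (x n)) (x n) k) (uN (x n) k))"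
  shows "ennreal \<alpha> * value_inf f XX UU l x0 \<le> ennreal \<alpha> * closed_loop_cost f l uN s x0 \<and>
         ennreal \<alpha> * closed_loop_cost f l uN s x0 \<le> ennreal (value_fin f XX UU l N x0) \<and>
         ennreal (value_fin f XX UU l N x0) \<le> value_inf f XX UU l x0"
proof -
  have l_nonneg: "l y u \<ge> 0" for y u
    using optimal_control_problem.l_nonneg[OF assms(1)] .
  have steps: "step_length s n \<in> {1..N}" and pos: "step_length s n \<ge> 1" for n
    using assms(4)[of n] by auto
  have uN_admissible: "uN y \<in> admissible_fin f XX UU N y" if "y \<in> XX" for y
    using assms(5)[OF that] by (simp add: is_minimizer_def is_arg_min_def)
  have "value_inf f XX UU l x0 \<le> cost_inf f l x0 (concat_control f uN s x0)"
    unfolding value_inf_def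
    using concat_control_admissible[OF steps assms(3) uN_admissible assms(6)] by (rule INF_lower)
  then have closed_loop_suboptimal: "value_inf f XX UU l x0 \<le> closed_loop_cost f l uN s x0"
    unfolding cost_inf_concat_control[OF pos assms(3)] .
  have x_in: "x n \<in> XX" for n
    unfolding assms(9) using mpc_state_in_constraints[OF steps uN_admissible assms(6)] .
  let ?c = "\<lambda>n. \<Sum>k<step_length s n. l (traj f (uN (x n)) (x n) k) (uN (x n) k)"
  have "closed_loop_cost f l uN s x0 = (\<Sum>n. ennreal (?c n))"
    unfolding closed_loop_cost_open_loop assms(9) by (simp add: l_nonneg)
  moreover have "ennreal \<alpha> * (\<Sum>n. ennreal (?c n)) \<le> ennreal (value_fin f XX UU l N (x 0))"
  proof (rule suminf_le_of_decrease[where V = "\<lambda>n. value_fin f XX UU l N (x n)"])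
    show "value_fin f XX UU l N (x n) \<ge> 0" for n
      using uN_admissible[OF x_in] l_nonneg by (intro value_fin_nonneg) auto
  qed (use assms(7,10) l_nonneg in \<open>auto intro: sum_nonneg\<close>)
  ultimately have "ennreal \<alpha> * closed_loop_cost f l uN s x0 \<le> ennreal (value_fin f XX UU l N x0)"
    by (simp add: assms(9))
  then show ?thesis
    using mult_left_mono[OF closed_loop_suboptimal] value_fin_le_value_inf[of l, OF l_nonneg]
    by simp
qed

end
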